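(* For integers $m,n\ge 3$, \[ s(K_m\Box K_n)=cs(K_m\Box K_n)=\alpha(m,n), \] where \[ \alpha(m,n) = \min\left\{mn-\sum_{i=1}^2m_in_i +\max\left\{\left\lceil\frac{\max\{m_1n_1,m_2n_2\} - mn+\sum_{i=1}^2m_in_i}{2}\right\rceil ,1 \right\} \right\}, \] the minimum being taken over all $((m_1,m_2),(n_1,n_2))$ with $m_1,m_2,n_1,n_2$ positive integers, $m_1+m_2=m$ and $n_1+n_2=n$.
   Context: For a connected graph $G$ and $X\subseteq V(G)$, $G[X]$ denotes the subgraph induced by $X$. A set $S\subseteq V(G)$ is a safe set if for every component $C$ of $G[S]$ and every component $D$ of $G-S$ such that some edge joins $C$ and $D$, we have $|C|\ge |D|$. If moreover $G[S]$ is connected, $S$ is a connected safe set. The safe number $s(G)$ (resp. connected safe number $cs(G)$) is the minimum size of a safe set (resp. connected safe set) of $G$. $K_m \Box K_n$ has vertex set $[m]\times[n]$, with $(i,j)$ and $(i',j')$ adjacent iff either $i=i'$ and $j\neq j'$, or $j=j'$ and $i\ne i'$. *)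

theory Defs
  imports Complex_Main "Graph_Theory.Graph_Theory"
begin

(* Undirected simple graphs are the symmetric loop-free digraphs of Graph_Theory (locale graph);
   an edge uv is the pair of arcs u \<rightarrow> v and v \<rightarrow> u. *)

definition graph_components :: "('a, 'b) pre_digraph \<Rightarrow> ('a, 'b) pre_digraph set" where
  "graph_components G = {C. pre_digraph.max_subgraph G Digraph_Component.connected C}"

lemma (in sym_digraph) connected_iff_strongly_connected_induced:
  assumes "induced_subgraph H G"
  shows "Digraph_Component.connected H \<longleftrightarrow> strongly_connected H"
proof -
  interpret H: sym_digraph H using assms by (rule induced_graph_imp_graph)
  have "arcs_ends (with_proj (mk_symmetric H)) = arcs_ends H"
    using H.graph_symmetric by (auto simp: mk_symmetric_def arcs_ends_def arc_to_ends_def)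
  moreover have "verts (with_proj (mk_symmetric H)) = verts H" by (simp add: mk_symmetric_def)
  ultimately show ?thesis unfolding connected_def strongly_connected_def reachable_def by simp
qed

lemma arc_mono_connected:
  "arc_mono (Digraph_Component.connected :: ('a, 'b) pre_digraph \<Rightarrow> bool)"
proof -
  { fix H1 H2 :: "('a, 'b) pre_digraph"
    assume c: "Digraph_Component.connected H1" and s: "subgraph H1 H2" "verts H1 = verts H2"
    then interpret H2: wf_digraph H2 by (simp add: subgraph_def)
    have "spanning H1 H2" using s by (simp add: spanning_def)
    then have "Digraph_Component.connected H2" using c by (rule H2.connected_spanning_imp_connected)
  }
  then show ?thesis unfolding arc_mono_def by blast
qed

lemma (in sym_digraph) graph_components_eq_sccs: "graph_components G = sccs"
proof (intro set_eqI iffI)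
  fix H assume "H \<in> graph_components G"
  then have m: "max_subgraph Digraph_Component.connected H" by (simp add: graph_components_def)
  then have i: "induced_subgraph H G" by (rule induced_subgraphI_arc_mono[OF _ arc_mono_connected])
  have c: "strongly_connected H"
    using m connected_iff_strongly_connected_induced[OF i] by (simp add: max_subgraph_def)
  { fix H' assume h: "induced_subgraph H' G" "strongly_connected H'" "verts H \<subset> verts H'"
    then have "subgraph H H'" using i
      by (auto simp: induced_subgraph_def subgraph_def compatible_def)
    moreover have "H' \<noteq> H" "subgraph H' G" "Digraph_Component.connected H'"
      using h connected_iff_strongly_connected_induced[OF h(1)] by (auto simp: induced_subgraph_def)
    ultimately have False using m by (auto simp: max_subgraph_def)
  }
  then show "H \<in> sccs" using i c by (auto simp: sccs_def)
next
  fix H assume "H \<in> sccs"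
  then have i: "induced_subgraph H G" and c: "strongly_connected H"
    and mx: "\<And>H'. induced_subgraph H' G \<Longrightarrow> strongly_connected H' \<Longrightarrow> \<not> verts H \<subset> verts H'"
    by (auto simp: sccs_def)
  { fix H' assume h: "H' \<noteq> H" "subgraph H H'" "subgraph H' G" "Digraph_Component.connected H'"
    let ?K = "G \<restriction> verts H'"
    have k: "induced_subgraph ?K G" using h by (auto intro: induced_induce)
    have "subgraph H' ?K" using h(3) k
      by (auto simp: subgraph_def compatible_def induced_subgraph_def wf_digraph_def)
    then have "Digraph_Component.connected ?K"
      using h(4) arc_mono_connected[unfolded arc_mono_def, rule_format, of H' ?K] by simp
    then have "\<not> verts H \<subset> verts H'"
      using mx[OF k] connected_iff_strongly_connected_induced[OF k] by simp
    then have "verts H = verts H'" using h(2) by (auto simp: subgraph_def)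
    have t: "tail H' = tail G" "head H' = head G" "tail H' = tail H" "head H' = head H"
      using h(2,3) by (auto simp: subgraph_def compatible_def)
    interpret H': wf_digraph H' using h(3) by (simp add: subgraph_def)
    have "arcs H' \<subseteq> arcs H"
    proof
      fix e assume e: "e \<in> arcs H'"
      then have "e \<in> arcs G" "tail G e \<in> verts H" "head G e \<in> verts H"
        using h(3) H'.wellformed[OF e] t \<open>verts H = verts H'\<close> by (auto simp: subgraph_def)
      then show "e \<in> arcs H" using i by (simp add: induced_subgraph_def)
    qed
    then have "arcs H = arcs H'" using h(2) by (auto simp: subgraph_def)
    with \<open>verts H = verts H'\<close> t have "H = H'" by simp
    then have False using h by simp }
  then show "H \<in> graph_components G" using i c connected_iff_strongly_connected_induced[OF i]
    by (auto simp: graph_components_def max_subgraph_def induced_subgraph_def)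
qed

(* The empty set would satisfy the component condition vacuously and make both numbers 0,
   so safe sets are required to be nonempty. Connectedness in Graph_Theory already
   excludes the empty graph. *)
definition safe_set :: "('a, 'b) pre_digraph \<Rightarrow> 'a set \<Rightarrow> bool" where
  "safe_set G S \<longleftrightarrow> S \<noteq> {} \<and> S \<subseteq> verts G \<and>
     (\<forall>C \<in> graph_components (G \<restriction> S). \<forall>D \<in> graph_components (G \<restriction> (verts G - S)).
        (\<exists>u \<in> verts C. \<exists>v \<in> verts D. u \<rightarrow>\<^bsub>G\<^esub> v) \<longrightarrow> card (verts C) \<ge> card (verts D))"

definition connected_safe_set :: "('a, 'b) pre_digraph \<Rightarrow> 'a set \<Rightarrow> bool" where
  "connected_safe_set G S \<longleftrightarrow> safe_set G S \<and> Digraph_Component.connected (G \<restriction> S)"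

definition safe_number :: "('a, 'b) pre_digraph \<Rightarrow> nat" where
  "safe_number G = Min {card S | S. safe_set G S}"

definition connected_safe_number :: "('a, 'b) pre_digraph \<Rightarrow> nat" where
  "connected_safe_number G = Min {card S | S. connected_safe_set G S}"

definition complete_box_complete :: "nat \<Rightarrow> nat \<Rightarrow> (nat \<times> nat) pair_pre_digraph" where
  "complete_box_complete m n =
     \<lparr> pverts = {1..m} \<times> {1..n},
       parcs = {((i, j), (i', j')) | i j i' j'.
                  (i, j) \<in> {1..m} \<times> {1..n} \<and> (i', j') \<in> {1..m} \<times> {1..n} \<and>
                  (i = i' \<and> j \<noteq> j' \<or> j = j' \<and> i \<noteq> i')} \<rparr>"

lemma pair_graph_complete_box_complete: "pair_graph (complete_box_complete m n)"
proof unfold_locales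
  have "parcs (complete_box_complete m n) \<subseteq> ({1..m} \<times> {1..n}) \<times> ({1..m} \<times> {1..n})"
    by (auto simp: complete_box_complete_def)
  then show "finite (parcs (complete_box_complete m n))"
    by (rule finite_subset) auto
  show "symmetric (with_proj (complete_box_complete m n))"
    by (auto simp: symmetric_def complete_box_complete_def intro!: symI)
qed (auto simp: complete_box_complete_def)

(* Computed in int, so that the numerator under the ceiling may be negative. *)
definition alpha :: "nat \<Rightarrow> nat \<Rightarrow> int" where
  "alpha m n =
     Min {int m * int n - int (m1 * n1 + m2 * n2)
          + max \<lceil>real_of_int (int (max (m1 * n1) (m2 * n2)) - int m * int n
                             + int (m1 * n1 + m2 * n2)) / 2\<rceil> 1
         | m1 m2 n1 n2 :: nat.
           m1 \<ge> 1 \<and> m2 \<ge> 1 \<and> n1 \<ge> 1 \<and> n2 \<ge> 1 \<and> m1 + m2 = m \<and> n1 + n2 = n}"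

end

(* A split m = m1 + m2, n = n1 + n2 cuts the grid into diagonal blocks of sizes a = m1 n1 and
   b = m2 n2 and off-diagonal blocks of total size s = m1 n2 + m2 n1; its cost is
   max (s + 1) (ceiling ((m n - min a b) / 2)). For a >= b, the off-diagonal blocks together with
   enough cells of the block of size a form a connected safe set; b is harmless because b <= s.

   Conversely let S be safe with complement T. If 2 |S| >= m n, the split (1, m - 1), (1, n - 1) is
   cheap enough. Otherwise some column has more than half of its cells in T; these lie in one
   component D of T, whose row set R has more than m / 2 elements. As T lies in R x C and the
   complementary block, its size forces the column set C of D to have more than n / 2 elements.
   The off-diagonal blocks of this split lie in S. They cannot be all of S, since the component
   R x C' of S would be smaller than D = R x C. So S has a further cell, which connects it, and
   |T| <= |D| + b <= |S| + b. *)

theory Submission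
  imports Defs
begin

(* Adjacency in the rook graph, made reflexive. *)
definition same_line :: "'a \<times> 'b \<Rightarrow> 'a \<times> 'b \<Rightarrow> bool" where
  "same_line u v \<longleftrightarrow> fst u = fst v \<or> snd u = snd v"

section \<open>Components of a set of cells\<close>

text \<open>This is the component of \<open>u\<close> in the rook graph on \<open>X\<close>, as a
  set of cells. Since \<open>rtrancl_on X\<close> is reflexive only on \<open>X\<close>, cells
  outside \<open>X\<close> have empty class.\<close>

definition line_class :: "('a \<times> 'b) set \<Rightarrow> 'a \<times> 'b \<Rightarrow> ('a \<times> 'b) set" where
  "line_class X u = {v. (u, v) \<in> rtrancl_on X {(p, q). same_line p q}}"

lemma line_class_subset: "line_class X u \<subseteq> X"
  by (auto simp: line_class_def dest: in_rtrancl_on_in_F)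

lemma line_class_self: "u \<in> X \<Longrightarrow> u \<in> line_class X u"
  by (simp add: line_class_def)

lemma line_class_step:
  assumes "v \<in> line_class X u" "same_line v w" "w \<in> X"
  shows "w \<in> line_class X u"
  using assms rtrancl_on_into_rtrancl_on[of u v X "{(p, q). same_line p q}" w]
  by (simp add: line_class_def)

text \<open>Used to bound classes from above: a block closed under moves inside \<open>X\<close>
  contains every class that starts in it.\<close>

lemma line_class_subset_closed:
  assumes "u \<in> K" and "\<And>v w. v \<in> K \<Longrightarrow> w \<in> X \<Longrightarrow> same_line v w \<Longrightarrow> w \<in> K"
  shows "line_class X u \<subseteq> K"
proof
  fix v assume "v \<in> line_class X u"
  then have "(u, v) \<in> rtrancl_on X {(p, q). same_line p q}" by (simp add: line_class_def)
  then show "v \<in> K" by (induct rule: rtrancl_on_induct) (auto intro: assms)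
qed

lemma line_class_sym:
  assumes "v \<in> line_class X u" shows "u \<in> line_class X v"
proof -
  let ?r = "{(p, q). same_line p q} :: (('a \<times> 'b) \<times> ('a \<times> 'b)) set"
  have "?r\<inverse> = ?r" by (auto simp: same_line_def)
  then show ?thesis using assms rtrancl_on_converseI[of u v X ?r]
    unfolding line_class_def by (simp only: mem_Collect_eq)
qed

lemma line_class_trans:
  "v \<in> line_class X u \<Longrightarrow> w \<in> line_class X v \<Longrightarrow> w \<in> line_class X u"
  unfolding line_class_def by (auto intro: rtrancl_on_trans)

lemma line_class_eq: "v \<in> line_class X u \<Longrightarrow> line_class X v = line_class X u"
  by (meson line_class_sym line_class_trans subsetI subset_antisym)

section \<open>Safe sets of the rook graph in terms of cells\<close>

text \<open>Safety compares only vertex sets of components. In a symmetric digraph these are the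
  classes of mutual reachability.\<close>

lemma (in sym_digraph) verts_graph_components:
  "verts ` graph_components G = scc_of ` verts G"
  by (simp add: graph_components_eq_sccs flip: sccs_verts_conv sccs_verts_conv_scc_of)

context
  fixes m n :: nat
begin

abbreviation (input) "grid \<equiv> {1..m} \<times> {1..n}"
abbreviation (input) "rook \<equiv> with_proj (complete_box_complete m n)"

lemma verts_rook: "verts rook = grid"
  by (simp add: complete_box_complete_def)

lemma dominates_rook_iff:
  "u \<rightarrow>\<^bsub>rook\<^esub> v \<longleftrightarrow> u \<in> grid \<and> v \<in> grid \<and> u \<noteq> v \<and> same_line u v"
  by (cases u; cases v) (auto simp: complete_box_complete_def same_line_def)

lemma sym_digraph_rook: "sym_digraph rook"
proof -
  interpret pair_graph "complete_box_complete m n" by (rule pair_graph_complete_box_complete)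
  show ?thesis by unfold_locales
qed

lemma dominates_induced_rook_iff:
  assumes "X \<subseteq> grid"
  shows "u \<rightarrow>\<^bsub>rook \<restriction> X\<^esub> v \<longleftrightarrow> u \<in> X \<and> v \<in> X \<and> u \<noteq> v \<and> same_line u v"
proof -
  have "u \<rightarrow>\<^bsub>rook \<restriction> X\<^esub> v \<longleftrightarrow> u \<in> X \<and> v \<in> X \<and> u \<rightarrow>\<^bsub>rook\<^esub> v"
    by (auto simp: arcs_ends_def arc_to_ends_def)
  then show ?thesis unfolding dominates_rook_iff using assms by auto
qed

lemma induced_rook:
  assumes "X \<subseteq> grid"
  shows "induced_subgraph (rook \<restriction> X) rook" and "sym_digraph (rook \<restriction> X)"
proof -
  interpret sym_digraph rook by (rule sym_digraph_rook)
  show "induced_subgraph (rook \<restriction> X) rook"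
    using assms by (intro induced_induce) (simp only: verts_rook)
  then show "sym_digraph (rook \<restriction> X)" by (rule induced_graph_imp_graph)
qed

lemma reachable_induced_rook_iff:
  assumes "X \<subseteq> grid"
  shows "u \<rightarrow>\<^sup>*\<^bsub>rook \<restriction> X\<^esub> v \<longleftrightarrow> v \<in> line_class X u"
proof
  interpret H: sym_digraph "rook \<restriction> X" by (rule induced_rook(2)[OF assms])
  assume "u \<rightarrow>\<^sup>*\<^bsub>rook \<restriction> X\<^esub> v"
  then show "v \<in> line_class X u"
  proof (induct rule: H.reachable_induct)
    case base
    then show ?case by (simp add: line_class_self)
  next
    case (step x y)
    then show ?case unfolding dominates_induced_rook_iff[OF assms]
      by (blast intro: line_class_step)
  qed
next
  interpret H: sym_digraph "rook \<restriction> X" by (rule induced_rook(2)[OF assms])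
  assume "v \<in> line_class X u"
  then have "(u, v) \<in> rtrancl_on X {(p, q). same_line p q}" by (simp add: line_class_def)
  then show "u \<rightarrow>\<^sup>*\<^bsub>rook \<restriction> X\<^esub> v"
  proof (induct rule: rtrancl_on_induct)
    case base
    then show ?case by simp
  next
    case (step y z)
    show ?case
    \<comment> \<open>A \<open>same_line\<close> step may stay in place, which is no arc of the
      loop-free graph.\<close>
    proof (cases "y = z")
      case False
      then have "y \<rightarrow>\<^bsub>rook \<restriction> X\<^esub> z" using step unfolding dominates_induced_rook_iff[OF assms] by simp
      then show ?thesis using step(5) H.reachable_trans H.reachable_adjI by blast
    qed (use step in simp)
  qed
qed

lemma connected_induced_rook_iff:
  assumes "X \<subseteq> grid"
  shows "Digraph_Component.connected (rook \<restriction> X) \<longleftrightarrow> X \<noteq> {} \<and> (\<forall>u\<in>X. line_class X u = X)"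
proof -
  interpret sym_digraph rook by (rule sym_digraph_rook)
  have "Digraph_Component.connected (rook \<restriction> X) \<longleftrightarrow> strongly_connected (rook \<restriction> X)"
    using induced_rook(1)[OF assms] by (rule connected_iff_strongly_connected_induced)
  also have "\<dots> \<longleftrightarrow> X \<noteq> {} \<and> (\<forall>u\<in>X. line_class X u = X)"
    unfolding strongly_connected_def reachable_induced_rook_iff[OF assms] induce_subgraph_verts
    using line_class_subset by blast
  finally show ?thesis .
qed

lemma components_induced_rook:
  assumes "X \<subseteq> grid"
  shows "verts ` graph_components (rook \<restriction> X) = line_class X ` X"
proof -
  interpret H: sym_digraph "rook \<restriction> X" by (rule induced_rook(2)[OF assms])
  have "H.scc_of u = line_class X u" for u
    unfolding H.scc_of_def reachable_induced_rook_iff[OF assms]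
    by (auto intro: line_class_sym)
  then show ?thesis unfolding H.verts_graph_components by simp
qed

text \<open>The ends \<open>u\<close>, \<open>v\<close> of a joining edge serve as representatives
  of their components. As \<open>u\<close> is in \<open>S\<close> and \<open>v\<close> is not, they
  are distinct, so \<open>same_line\<close> is adjacency here.\<close>

lemma safe_set_rook_iff:
  "safe_set rook S \<longleftrightarrow> S \<noteq> {} \<and> S \<subseteq> grid \<and>
     (\<forall>u\<in>S. \<forall>v\<in>grid - S. same_line u v \<longrightarrow> card (line_class (grid - S) v) \<le> card (line_class S u))"
proof (cases "S \<subseteq> grid")
  case True
  let ?P = "\<lambda>C D. (\<exists>u\<in>C. \<exists>v\<in>D. u \<rightarrow>\<^bsub>rook\<^esub> v) \<longrightarrow> card D \<le> card C"
  have "(\<forall>C \<in> graph_components (rook \<restriction> S). \<forall>D \<in> graph_components (rook \<restriction> (grid - S)). ?P (verts C) (verts D))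
    \<longleftrightarrow> (\<forall>C \<in> verts ` graph_components (rook \<restriction> S).
          \<forall>D \<in> verts ` graph_components (rook \<restriction> (grid - S)). ?P C D)"
    by blast
  also have "\<dots> \<longleftrightarrow> (\<forall>C \<in> line_class S ` S. \<forall>D \<in> line_class (grid - S) ` (grid - S). ?P C D)"
    using components_induced_rook[OF True] components_induced_rook[of "grid - S"] by simp
  also have "\<dots> \<longleftrightarrow> (\<forall>u\<in>S. \<forall>v\<in>grid - S. same_line u v \<longrightarrow>
      card (line_class (grid - S) v) \<le> card (line_class S u))" (is "?L \<longleftrightarrow> ?R")
  proof
    assume L: ?L
    show ?R
    proof (intro ballI impI)
      fix u v assume uv: "u \<in> S" "v \<in> grid - S" "same_line u v"
      then have "u \<rightarrow>\<^bsub>rook\<^esub> v" using True unfolding dominates_rook_iff by blast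
      then show "card (line_class (grid - S) v) \<le> card (line_class S u)"
        using L uv line_class_self[of u S] line_class_self[of v "grid - S"] by blast
    qed
  next
    assume R: ?R
    show ?L
    proof (intro ballI impI)
      fix C D assume CD: "C \<in> line_class S ` S" "D \<in> line_class (grid - S) ` (grid - S)"
        and ex: "\<exists>u\<in>C. \<exists>v\<in>D. u \<rightarrow>\<^bsub>rook\<^esub> v"
      then obtain u v where uv: "u \<in> C" "v \<in> D" "same_line u v"
        unfolding dominates_rook_iff by blast
      have "C = line_class S u" "D = line_class (grid - S) v"
        using CD uv line_class_eq by blast+
      moreover have "u \<in> S" "v \<in> grid - S" using CD uv line_class_subset by blast+
      ultimately show "card D \<le> card C" using R uv by blast
    qed
  qed
  finally show ?thesis unfolding safe_set_def verts_rook using True by blast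
qed (simp only: safe_set_def verts_rook, blast)

end

section \<open>Connectedness of the off-diagonal blocks with a further cell\<close>

text \<open>The cell \<open>s\<close> lies in a diagonal block, so its row and column each run
  through an off-diagonal block. It reaches any other cell \<open>v\<close> with one turn, or with
  two turns when both lie in the same diagonal block.\<close>

lemma line_class_cross:
  assumes S: "R \<times> C' \<union> R' \<times> C \<subseteq> S" "S \<subseteq> (R \<union> R') \<times> (C \<union> C')"
    and ne: "C \<noteq> {}" "C' \<noteq> {}"
    and s: "s \<in> S" "s \<notin> R \<times> C' \<union> R' \<times> C" and u: "u \<in> S"
  shows "line_class S u = S"
proof -
  have "v \<in> line_class S s" if v: "v \<in> S" for v
  proof -
    obtain i0 j0 i j where ij: "s = (i0, j0)" "v = (i, j)" by (cases s; cases v) auto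
    obtain c c' where c: "c \<in> C" "c' \<in> C'" using ne by blast
    have "\<exists>p\<in>S. \<exists>q\<in>S. same_line s p \<and> same_line p q \<and> same_line q v"
    proof -
      have si: "i0 \<in> R \<and> j0 \<in> C \<or> i0 \<in> R' \<and> j0 \<in> C'" using S s ij by blast
      have vi: "i \<in> R \<and> j \<in> C \<or> i \<in> R' \<and> j \<in> C' \<or> i \<in> R \<and> j \<in> C' \<or> i \<in> R' \<and> j \<in> C"
        using S v ij by blast
      have 1: ?thesis if "(i0, j) \<in> S"
        using that v s ij by (intro bexI[of _ "(i0, j)"]) (auto simp: same_line_def)
      have 2: ?thesis if "(i, j0) \<in> S"
        using that v s ij by (intro bexI[of _ "(i, j0)"]) (auto simp: same_line_def)
      \<comment> \<open>The case of two turns: along the row of \<open>s\<close> to column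
        \<open>k\<close>, then to the row of \<open>v\<close>, with \<open>k\<close> chosen so that
        both turns are off-diagonal.\<close>
      have 3: ?thesis if "(i0, k) \<in> S" "(i, k) \<in> S" for k
        using that v s ij
        by (intro bexI[of _ "(i0, k)"] bexI[of _ "(i, k)"]) (auto simp: same_line_def)
      show ?thesis using si vi 1 2 3[of c] 3[of c'] c S by blast
    qed
    then show ?thesis using line_class_self[OF s(1)] line_class_step v by blast
  qed
  then have "line_class S s = S" using line_class_subset by blast
  then show ?thesis using line_class_eq[of u S s] u by simp
qed

section \<open>Cost of a split and the minimum \<open>alpha\<close>\<close>

text \<open>The term minimised in \<open>alpha\<close>, with \<open>m n\<close> minus the diagonal
  blocks rewritten as the off-diagonal size s. The maximum is the least x \<ge> 1 such that the
  larger diagonal block, after losing x cells, has at most s + x left.\<close>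

definition split_cost :: "nat \<Rightarrow> nat \<Rightarrow> nat \<Rightarrow> nat \<Rightarrow> int" where
  "split_cost m1 m2 n1 n2 = int (m1 * n2 + m2 * n1)
     + max \<lceil>real_of_int (int (max (m1 * n1) (m2 * n2)) - int (m1 * n2 + m2 * n1)) / 2\<rceil> 1"

text \<open>Removes the ceiling. With diagonal sizes a, b, the entry 1 of the maximum gives s < k.
  The other entry gives max a b + s \<le> 2k, and max a b = a + b - min a b.\<close>

lemma split_cost_le_iff:
  "split_cost m1 m2 n1 n2 \<le> int k \<longleftrightarrow> m1 * n2 + m2 * n1 < k \<and>
     (m1 + m2) * (n1 + n2) \<le> 2 * k + min (m1 * n1) (m2 * n2)"
proof -
  let ?a = "m1 * n1" and ?b = "m2 * n2" and ?s = "m1 * n2 + m2 * n1"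
  have cost: "int s + max \<lceil>real_of_int (int (max a b) - int s) / 2\<rceil> 1 \<le> int k \<longleftrightarrow>
      s < k \<and> a + b + s \<le> 2 * k + min a b" for a b s :: nat
  proof -
    have half: "\<lceil>real_of_int z / 2\<rceil> \<le> y \<longleftrightarrow> z \<le> 2 * y" for z y :: int
      unfolding ceiling_le_iff by linarith
    have "int s + max \<lceil>real_of_int (int (max a b) - int s) / 2\<rceil> 1 \<le> int k \<longleftrightarrow>
        \<lceil>real_of_int (int (max a b) - int s) / 2\<rceil> \<le> int k - int s \<and> 1 \<le> int k - int s"
      by linarith
    also have "\<dots> \<longleftrightarrow> s < k \<and> a + b + s \<le> 2 * k + min a b"
      unfolding half by (cases "a \<le> b"; simp add: max_def min_def; presburger)
    finally show ?thesis .
  qed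
  have "(m1 + m2) * (n1 + n2) = ?a + ?b + ?s" by (simp add: algebra_simps)
  then show ?thesis unfolding split_cost_def cost by (simp only:)
qed

lemma split_cost_swap: "split_cost m2 m1 n2 n1 = split_cost m1 m2 n1 n2"
  by (simp add: split_cost_def max.commute add.commute)

lemma alpha_altdef:
  "alpha m n = Min {split_cost m1 m2 n1 n2 | m1 m2 n1 n2.
     m1 \<ge> 1 \<and> m2 \<ge> 1 \<and> n1 \<ge> 1 \<and> n2 \<ge> 1 \<and> m1 + m2 = m \<and> n1 + n2 = n}" (is "_ = Min ?A")
proof -
  have cost: "int m * int n - int (m1 * n1 + m2 * n2)
          + max \<lceil>real_of_int (int (max (m1 * n1) (m2 * n2)) - int m * int n
                             + int (m1 * n1 + m2 * n2)) / 2\<rceil> 1 = split_cost m1 m2 n1 n2"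
    if "m1 + m2 = m" "n1 + n2 = n" for m1 m2 n1 n2
  proof -
    have *: "int m * int n = int (m1 * n1 + m2 * n2) + int (m1 * n2 + m2 * n1)"
      unfolding that[symmetric] by (simp add: algebra_simps)
    then have "int m * int n - int (m1 * n1 + m2 * n2) = int (m1 * n2 + m2 * n1)"
      and "k - int m * int n + int (m1 * n1 + m2 * n2) = k - int (m1 * n2 + m2 * n1)" for k
      by linarith+
    then show ?thesis unfolding split_cost_def by (simp only:)
  qed
  show ?thesis unfolding alpha_def
    by (rule arg_cong[where f = Min], rule Collect_cong, intro iff_exI) (metis cost)
qed

lemma finite_split_costs:
  "finite {split_cost m1 m2 n1 n2 | m1 m2 n1 n2.
     m1 \<ge> 1 \<and> m2 \<ge> 1 \<and> n1 \<ge> 1 \<and> n2 \<ge> 1 \<and> m1 + m2 = m \<and> n1 + n2 = n}"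
  by (rule finite_subset[of _ "(\<lambda>(m1, m2, n1, n2). split_cost m1 m2 n1 n2) ` ({..m} \<times> {..m} \<times> {..n} \<times> {..n})"])
    (force simp: image_iff)+

lemma alpha_le_split_cost:
  assumes "m1 \<ge> 1" "m2 \<ge> 1" "n1 \<ge> 1" "n2 \<ge> 1"
  shows "alpha (m1 + m2) (n1 + n2) \<le> split_cost m1 m2 n1 n2"
  unfolding alpha_altdef using assms by (intro Min_le finite_split_costs) blast

lemma alpha_attained:
  assumes "m \<ge> 2" "n \<ge> 2"
  obtains m1 m2 n1 n2 where "m1 \<ge> 1" "m2 \<ge> 1" "n1 \<ge> 1" "n2 \<ge> 1" "m1 + m2 = m" "n1 + n2 = n"
    "alpha m n = split_cost m1 m2 n1 n2"
proof -
  let ?A = "{split_cost m1 m2 n1 n2 | m1 m2 n1 n2.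
     m1 \<ge> 1 \<and> m2 \<ge> 1 \<and> n1 \<ge> 1 \<and> n2 \<ge> 1 \<and> m1 + m2 = m \<and> n1 + n2 = n}"
  \<comment> \<open>Some split must exist for \<open>Min\<close> to be attained.\<close>
  have "split_cost 1 (m - 1) 1 (n - 1) \<in> ?A"
    using assms by (intro CollectI exI conjI) auto
  then have "Min ?A \<in> ?A" by (intro Min_in finite_split_costs) blast
  then show thesis using that unfolding alpha_altdef by blast
qed

text \<open>The split cutting off one row and one column has m + n - 2 off-diagonal cells. From (m -
  2)(n - 2) \<ge> 1 follows 2(m + n - 2) < m n \<le> 2k.\<close>

lemma alpha_le_of_half:
  assumes "m \<ge> 3" "n \<ge> 3" "m * n \<le> 2 * k"
  shows "alpha m n \<le> int k"
proof -
  obtain a b where ab: "m = a + 3" "n = b + 3" using assms(1,2) le_Suc_ex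
    by (metis add.commute)
  have "split_cost 1 (m - 1) 1 (n - 1) \<le> int k"
  proof -
    have "(a + 3) * (b + 3) \<le> 2 * k" using assms(3) ab by simp
    then have h: "a * b + 3 * a + 3 * b + 9 \<le> 2 * k" by (simp add: algebra_simps)
    have "1 * (n - 1) + (m - 1) * 1 < k" using h ab by linarith
    moreover have "1 + (m - 1) = m" "1 + (n - 1) = n" using ab by simp_all
    then have "(1 + (m - 1)) * (1 + (n - 1)) \<le> 2 * k" using assms(3) by (simp only:)
    ultimately show ?thesis unfolding split_cost_le_iff by (intro conjI trans_le_add1)
  qed
  moreover have "alpha m n \<le> split_cost 1 (m - 1) 1 (n - 1)"
    using alpha_le_split_cost[of 1 "m - 1" 1 "n - 1"] assms by simp
  ultimately show ?thesis by linarith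
qed

section \<open>Upper bound: a connected safe set for each split\<close>

text \<open>The set consists of the off-diagonal blocks and x cells of the larger diagonal block.
  The two diagonal blocks share no row or column, so each component of the complement stays inside
  one of them.\<close>

lemma exists_connected_safe_set_rook:
  assumes pos: "m1 \<ge> 1" "m2 \<ge> 1" "n1 \<ge> 1" "n2 \<ge> 1" and ge: "m2 * n2 \<le> m1 * n1"
  shows "\<exists>S. connected_safe_set (with_proj (complete_box_complete (m1 + m2) (n1 + n2))) S
           \<and> int (card S) = split_cost m1 m2 n1 n2"
proof -
  define R where "R = {1..m1}"
  define R' where "R' = {m1+1..m1+m2}"
  define C where "C = {1..n1}"
  define C' where "C' = {n1+1..n1+n2}"
  note defs = R_def R'_def C_def C'_def
  have fin: "finite R" "finite R'" "finite C" "finite C'" by (auto simp: defs)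
  have card: "card R = m1" "card R' = m2" "card C = n1" "card C' = n2" by (auto simp: defs)
  have disj: "R \<inter> R' = {}" "C \<inter> C' = {}" by (auto simp: defs)
  have un: "{1..m1 + m2} = R \<union> R'" "{1..n1 + n2} = C \<union> C'" by (auto simp: defs)
  have ne: "C \<noteq> {}" "C' \<noteq> {}" using pos by (auto simp: defs)
  define s0 where "s0 = m1 * n2 + m2 * n1"
  \<comment> \<open>Either m2 \<le> m1 and m2 n2 \<le> m1 n2, or m2 n2 \<le> m1 n1 \<le> m2
    n1.\<close>
  have b_le: "m2 * n2 \<le> s0"
  proof (cases "m2 \<le> m1")
    case True
    then show ?thesis unfolding s0_def by (intro trans_le_add1 mult_le_mono1)
  next
    case False
    then have "m1 * n1 \<le> m2 * n1" by simp
    with ge show ?thesis unfolding s0_def by linarith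
  qed
  define x where "x = nat (split_cost m1 m2 n1 n2 - int s0)"
  have "int s0 < split_cost m1 m2 n1 n2" unfolding split_cost_def s0_def by linarith
  then have x: "int x = split_cost m1 m2 n1 n2 - int s0" "x \<ge> 1" unfolding x_def by linarith+
  have "(m1 + m2) * (n1 + n2) = m1 * n1 + m2 * n2 + s0" by (simp add: s0_def algebra_simps)
  then have cost: "split_cost m1 m2 n1 n2 \<le> int k \<longleftrightarrow> s0 < k \<and> m1 * n1 + s0 \<le> 2 * k" for k
    unfolding split_cost_le_iff using ge by (simp add: s0_def)
  have "m1 * n1 \<ge> 1" using pos mult_le_mono[of 1 m1 1 n1] by simp
  \<comment> \<open>Adding the whole first block would meet the cost bound, so that block has room
    for \<open>x\<close> cells.\<close>
  then have "split_cost m1 m2 n1 n2 \<le> int (s0 + m1 * n1)" unfolding cost by simp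
  then have "x \<le> m1 * n1" using x by linarith
  then obtain X where X: "X \<subseteq> R \<times> C" "card X = x" "finite X"
    using obtain_subset_with_card_n[of x "R \<times> C"] card by (metis card_cartesian_product)
  \<comment> \<open>The criterion \<open>cost\<close> at the exact value k = s0 + x: the rest of the
    first block is no larger than \<open>S\<close>.\<close>
  have half: "m1 * n1 - x \<le> s0 + x" using cost[of "s0 + x"] x by simp
  define S where "S = R \<times> C' \<union> R' \<times> C \<union> X"
  have "card S = s0 + x"
  proof -
    have "card (R \<times> C' \<union> R' \<times> C) = s0"
      using fin disj card by (subst card_Un_disjoint) (auto simp: s0_def card_cartesian_product)
    moreover have "(R \<times> C' \<union> R' \<times> C) \<inter> X = {}" using X disj by blast
    ultimately show ?thesis unfolding S_def using X fin by (subst card_Un_disjoint) auto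
  qed
  have Sg: "S \<subseteq> (R \<union> R') \<times> (C \<union> C')" unfolding S_def using X by blast
  obtain s where s: "s \<in> X" using X x by (metis card.empty ex_in_conv not_one_le_zero)
  have conn: "line_class S u = S" if "u \<in> S" for u
    using that X s disj Sg by (intro line_class_cross[of R C' R' C S s u] ne) (auto simp: S_def)
  let ?T = "(R \<union> R') \<times> (C \<union> C') - S"
  have T: "card (line_class ?T v) \<le> card S" if v: "v \<in> ?T" for v
  proof (cases "v \<in> R \<times> C")
    case True
    then have "line_class ?T v \<subseteq> R \<times> C - X"
      using v disj by (intro line_class_subset_closed) (auto simp: S_def same_line_def)
    then have "card (line_class ?T v) \<le> card (R \<times> C - X)" using fin by (intro card_mono) auto
    also have "\<dots> = m1 * n1 - x" using X card fin
      by (simp add: card_Diff_subset card_cartesian_product)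
    finally show ?thesis using half \<open>card S = _\<close> by linarith
  next
    case False
    then have "v \<in> R' \<times> C'" using v by (auto simp: S_def)
    then have "line_class ?T v \<subseteq> R' \<times> C'"
      using v disj by (intro line_class_subset_closed) (auto simp: S_def same_line_def)
    then have "card (line_class ?T v) \<le> card (R' \<times> C')" using fin by (intro card_mono) auto
    then show ?thesis using b_le \<open>card S = _\<close> card by (simp add: card_cartesian_product)
  qed
  have "S \<noteq> {}" using s unfolding S_def by blast
  then have "connected_safe_set (with_proj (complete_box_complete (m1 + m2) (n1 + n2))) S"
    using connected_induced_rook_iff[of S "m1 + m2" "n1 + n2"] Sg conn T
    unfolding connected_safe_set_def safe_set_rook_iff un by simp
  moreover have "int (card S) = split_cost m1 m2 n1 n2" using \<open>card S = _\<close> x by simp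
  ultimately show ?thesis by blast
qed

section \<open>Lower bound: a split cheap enough for each safe set\<close>

text \<open>Averaging over the \<open>n\<close> columns: if each met \<open>T\<close> in at most m/2
  cells, \<open>T\<close> would have at most m n / 2.\<close>

lemma exists_heavy_column:
  assumes "T \<subseteq> {1..m} \<times> {1..n::nat}" "m * n < 2 * card T"
  obtains j where "m < 2 * card {i. (i, j) \<in> T}"
proof (rule ccontr)
  assume "\<not> thesis"
  then have le: "2 * card {i. (i, j) \<in> T} \<le> m" for j using that by (meson not_less)
  have fin: "finite T" using assms(1) by (rule finite_subset) simp
  have "T = (\<lambda>(j, i). (i, j)) ` (SIGMA j:{1..n}. {i. (i, j) \<in> T})" using assms(1) by force
  moreover have col: "finite {i. (i, j) \<in> T}" for j
    by (rule finite_subset[of _ "fst ` T"]) (use fin in force)+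
  ultimately have "card T \<le> card (SIGMA j:{1..n}. {i. (i, j) \<in> T})"
    using card_image_le[of "SIGMA j:{1..n}. {i. (i, j) \<in> T}" "\<lambda>(j, i). (i, j)"] by simp
  also have "\<dots> = (\<Sum>j\<in>{1..n}. card {i. (i, j) \<in> T})"
    by (rule card_SigmaI) (simp_all add: col)
  finally have "2 * card T \<le> (\<Sum>j\<in>{1..n}. 2 * card {i. (i, j) \<in> T})"
    by (simp flip: sum_distrib_left)
  also have "\<dots> \<le> (\<Sum>j\<in>{1..n}. m)" by (intro sum_mono le)
  finally show False using assms(2) by (simp add: mult.commute)
qed

text \<open>When 2 |S| < m n, it suffices by \<open>split_cost_le_iff\<close> to find a split whose
  off-diagonal blocks have fewer cells than \<open>S\<close> and with m n \<le> 2 |S| + r'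
  c'.\<close>

lemma alpha_le_card_safe_set_rook:
  assumes m: "m \<ge> 3" and n: "n \<ge> 3"
    and safe: "safe_set (with_proj (complete_box_complete m n)) S"
  shows "alpha m n \<le> int (card S)"
proof (cases "m * n \<le> 2 * card S")
  case True
  then show ?thesis using m n by (intro alpha_le_of_half)
next
  case False
  define T where "T = {1..m} \<times> {1..n} - S"
  have S: "S \<noteq> {}" "S \<subseteq> {1..m} \<times> {1..n}"
    and safeD: "\<And>u v. u \<in> S \<Longrightarrow> v \<in> T \<Longrightarrow> same_line u v \<Longrightarrow> card (line_class T v) \<le> card (line_class S u)"
    using safe unfolding safe_set_rook_iff T_def by auto
  have finS: "finite S" using S by (rule_tac finite_subset) auto
  have finT: "finite T" and Tg: "T \<subseteq> {1..m} \<times> {1..n}" unfolding T_def by auto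
  have classS: "card (line_class S u) \<le> card S" for u
    by (intro card_mono finS line_class_subset)
  have cardT: "card S + card T = m * n"
    using card_Diff_subset[OF finS S(2)] card_mono[OF _ S(2)] unfolding T_def
    by (simp add: card_cartesian_product)
  then have "m * n < 2 * card T" using False by linarith
  then obtain j where j: "m < 2 * card {i. (i, j) \<in> T}" using exists_heavy_column[OF Tg] by blast
  then have "{i. (i, j) \<in> T} \<noteq> {}" by force
  then obtain i where d: "(i, j) \<in> T" by blast
  define D where "D = line_class T (i, j)"
  define R where "R = fst ` D"
  define C where "C = snd ` D"
  define R' where "R' = {1..m} - R"
  define C' where "C' = {1..n} - C"
  have DT: "D \<subseteq> T" and dD: "(i, j) \<in> D"
    unfolding D_def by (rule line_class_subset, rule line_class_self[OF d])
  have Deq: "line_class T v = D" if "v \<in> D" for v using that line_class_eq unfolding D_def by blast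
  have closed: "w \<in> D" if "v \<in> D" "w \<in> T" "same_line v w" for v w
    using that line_class_step unfolding D_def by blast
  \<comment> \<open>Cells of \<open>T\<close> in a row or column met by \<open>D\<close> are in
    \<open>D\<close>, so the rest of \<open>T\<close> lies in \<open>R' \<times> C'\<close>.\<close>
  have rowD: "w \<in> D" if w: "w \<in> T" "fst w \<in> R" for w
  proof -
    obtain v where "v \<in> D" "fst v = fst w" using w(2) unfolding R_def by (metis imageE)
    then show ?thesis using closed[of v w] w(1) by (simp add: same_line_def)
  qed
  have colD: "w \<in> D" if w: "w \<in> T" "snd w \<in> C" for w
  proof -
    obtain v where "v \<in> D" "snd v = snd w" using w(2) unfolding C_def by (metis imageE)
    then show ?thesis using closed[of v w] w(1) by (simp add: same_line_def)
  qed
  have RC: "R \<subseteq> {1..m}" "C \<subseteq> {1..n}" using DT Tg unfolding R_def C_def by force+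
  have fin: "finite R" "finite C" "finite R'" "finite C'"
    using RC finite_subset unfolding R'_def C'_def by auto
  have un: "{1..m} = R \<union> R'" "{1..n} = C \<union> C'" and disj: "R \<inter> R' = {}" "C \<inter> C' = {}"
    using RC unfolding R'_def C'_def by auto
  define r where "r = card R"
  define c where "c = card C"
  define r' where "r' = card R'"
  define c' where "c' = card C'"
  have mn: "m = r + r'" "n = c + c'"
    using card_Un_disjoint[OF fin(1,3) disj(1)] card_Un_disjoint[OF fin(2,4) disj(2)]
    unfolding r_def r'_def c_def c'_def un[symmetric] by simp_all
  have DRC: "D \<subseteq> R \<times> C" unfolding R_def C_def by force
  have Tsub: "T \<subseteq> D \<union> R' \<times> C'" using rowD colD Tg unfolding un by force
  have cardD: "card D \<le> r * c" "card T \<le> card D + r' * c'"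
  proof -
    show "card D \<le> r * c"
      using card_mono[OF _ DRC] fin by (simp add: r_def c_def card_cartesian_product)
    have "card T \<le> card (D \<union> R' \<times> C')"
      using Tsub fin finite_subset[OF DT finT] by (intro card_mono) auto
    also have "\<dots> \<le> card D + card (R' \<times> C')" by (rule card_Un_le)
    finally show "card T \<le> card D + r' * c'" by (simp add: r'_def c'_def card_cartesian_product)
  qed
  have r: "m < 2 * r"
  proof -
    have "{i. (i, j) \<in> T} \<subseteq> R"
    proof
      fix k assume "k \<in> {i. (i, j) \<in> T}"
      then have "(k, j) \<in> D" using closed[OF dD] by (simp add: same_line_def)
      then show "k \<in> R" unfolding R_def by force
    qed
    then have "card {i. (i, j) \<in> T} \<le> r" unfolding r_def using fin by (intro card_mono)
    then show ?thesis using j by linarith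
  qed
  \<comment> \<open>As 2(r c + r' c') - m n = (r - r')(c - c') and r > r', having c \<le> c' would
    give 2 |T| \<le> m n.\<close>
  have c: "c' < c"
  proof (rule ccontr)
    assume "\<not> c' < c"
    then obtain e where e: "c' = c + e" using le_Suc_ex by (metis not_less)
    obtain f where f: "r = r' + Suc f" using r mn less_imp_Suc_add[of r' r] by auto
    have "m * n < 2 * card T" by fact
    also have "\<dots> \<le> 2 * (r * c + r' * c')" using cardD by simp
    finally have "(r + r') * (c + c') < 2 * (r * c + r' * c')" unfolding mn .
    then show False unfolding e f by (simp add: algebra_simps)
  qed
  have rr: "r' < r" using r mn by linarith
  \<comment> \<open>Such a cell shares a line with a cell of \<open>D\<close>, so safety
    applies.\<close>
  have adj: "card D \<le> card (line_class S u)" if u: "u \<in> S" "fst u \<in> R \<or> snd u \<in> C" for u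
  proof -
    obtain v where "v \<in> D" "same_line u v"
      using u(2) unfolding R_def C_def same_line_def by (metis imageE)
    then show ?thesis using safeD[of u v] u DT Deq by auto
  qed
  \<comment> \<open>If \<open>D\<close> met all rows or all columns, it would be all of
    \<open>T\<close> and adjacent to every cell of \<open>S\<close>. Then |T| \<le> |S|, against 2
    |S| < m n.\<close>
  have pos: "r' \<ge> 1" "c' \<ge> 1"
  proof -
    have "\<not> (R' = {} \<or> C' = {})"
    proof
      assume full: "R' = {} \<or> C' = {}"
      then have "card T \<le> card D" using Tsub finite_subset[OF DT finT] by (intro card_mono) auto
      moreover obtain u where "u \<in> S" using S by blast
      moreover have "fst u \<in> R \<or> snd u \<in> C" using full S \<open>u \<in> S\<close> unfolding un by force
      ultimately have "card T \<le> card S" using adj classS order_trans by metis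
      then show False using cardT False by linarith
    qed
    then show "r' \<ge> 1" "c' \<ge> 1" unfolding r'_def c'_def using fin by (simp_all add: Suc_le_eq card_gt_0_iff)
  qed
  have cross: "R \<times> C' \<union> R' \<times> C \<subseteq> S"
  proof
    fix w assume w: "w \<in> R \<times> C' \<union> R' \<times> C"
    show "w \<in> S"
    proof (rule ccontr)
      assume "w \<notin> S"
      then have "w \<in> T" using w un unfolding T_def by auto
      then have "w \<in> R \<times> C" using w rowD[of w] colD[of w] DRC by auto
      then show False using w disj by auto
    qed
  qed
  have cross_card: "card (R \<times> C' \<union> R' \<times> C) = r * c' + r' * c"
    using fin disj unfolding r_def r'_def c_def c'_def
    by (subst card_Un_disjoint) (auto simp: card_cartesian_product)
  have cne: "C \<noteq> {}" "C' \<noteq> {}" using pos c unfolding c_def c'_def by auto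
  obtain k where k: "k \<in> C'" using cne by blast
  have iR: "i \<in> R" using dD unfolding R_def by force
  have p: "(i, k) \<in> S" using cross iR k by blast
  \<comment> \<open>Otherwise \<open>D\<close> fills \<open>R \<times> C\<close>, while the class of
    \<open>(i, k)\<close> in \<open>S\<close> stays in \<open>R \<times> C'\<close>. Safety would
    give r c \<le> r c', against c' < c.\<close>
  have "S \<noteq> R \<times> C' \<union> R' \<times> C"
  proof
    assume eq: "S = R \<times> C' \<union> R' \<times> C"
    have "R \<times> C \<subseteq> D"
    proof
      fix w assume "w \<in> R \<times> C"
      moreover from this have "w \<in> T" unfolding T_def eq un using disj by auto
      ultimately show "w \<in> D" using rowD by auto
    qed
    then have "r * c \<le> card D" using finite_subset[OF DT finT] card_mono
      unfolding r_def c_def by (metis card_cartesian_product)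
    also have "\<dots> \<le> card (line_class S (i, k))" using adj[OF p] iR by simp
    also have "\<dots> \<le> card (R \<times> C')"
    proof (intro card_mono line_class_subset_closed)
      show "(i, k) \<in> R \<times> C'" using iR k by simp
      fix v w assume "v \<in> R \<times> C'" "w \<in> S" "same_line v w"
      then show "w \<in> R \<times> C'" unfolding eq same_line_def using disj by auto
    qed (use fin in simp)
    also have "\<dots> = r * c'" by (simp add: r_def c'_def card_cartesian_product)
    finally show False using c rr by simp
  qed
  then obtain s where s: "s \<in> S" "s \<notin> R \<times> C' \<union> R' \<times> C" using cross by blast
  \<comment> \<open>The further cell \<open>s\<close> makes the inequality for the off-diagonal size
    strict.\<close>
  have "R \<times> C' \<union> R' \<times> C \<subset> S" using s cross by blast
  then have "r * c' + r' * c < card S" using psubset_card_mono[OF finS] cross_card by metis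
  moreover have "card D \<le> card S" using adj[OF p] classS[of "(i, k)"] iR by simp
  then have "m * n \<le> 2 * card S + r' * c'" using cardT cardD by linarith
  \<comment> \<open>Since r' < r and c' < c, the block away from \<open>D\<close> is the smaller
    one, as the cost criterion requires.\<close>
  moreover have "min (r * c) (r' * c') = r' * c'"
    using mult_le_mono[of r' r c' c] rr c by simp
  ultimately have "split_cost r r' c c' \<le> int (card S)"
    unfolding split_cost_le_iff mn by (simp only: simp_thms)
  moreover have "alpha m n \<le> split_cost r r' c c'"
    using alpha_le_split_cost[of r r' c c'] pos rr c mn by simp
  ultimately show ?thesis by linarith
qed

section \<open>Equality of both safe numbers with \<open>alpha\<close>\<close>

text \<open>Connected safe sets are safe, so a connected one of size \<open>alpha\<close> and the
  lower bound for all safe sets fix both minima.\<close>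

theorem theorem2p11:
  fixes m n :: nat
  assumes "m \<ge> 3" and "n \<ge> 3"
  shows "int (safe_number (with_proj (complete_box_complete m n))) = alpha m n
       \<and> int (connected_safe_number (with_proj (complete_box_complete m n))) = alpha m n"
proof -
  let ?G = "with_proj (complete_box_complete m n)"
  obtain m1 m2 n1 n2 where pos: "m1 \<ge> 1" "m2 \<ge> 1" "n1 \<ge> 1" "n2 \<ge> 1"
    and sum: "m1 + m2 = m" "n1 + n2 = n" and al: "alpha m n = split_cost m1 m2 n1 n2"
    using alpha_attained[of m n] assms by (metis Suc_leD eval_nat_numeral(3))
  have "\<exists>S. connected_safe_set ?G S \<and> int (card S) = alpha m n"
  proof (cases "m2 * n2 \<le> m1 * n1")
    case True
    then show ?thesis using exists_connected_safe_set_rook[OF pos] al sum by simp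
  next
    \<comment> \<open>The two parts of the split change places, so that the larger diagonal block
      comes first.\<close>
    case False
    then show ?thesis
      using exists_connected_safe_set_rook[of m2 m1 n2 n1] pos al sum split_cost_swap
      by (simp add: add.commute)
  qed
  then obtain S where S: "connected_safe_set ?G S" "int (card S) = alpha m n" by blast
  have sub: "safe_set ?G X" if "connected_safe_set ?G X" for X
    using that by (simp add: connected_safe_set_def)
  have fin: "finite {card X | X. safe_set ?G X}"
  proof -
    have "{X. safe_set ?G X} \<subseteq> Pow ({1..m} \<times> {1..n})" using safe_set_rook_iff by blast
    then have "finite {X. safe_set ?G X}" by (rule finite_subset) simp
    then show ?thesis by simp
  qed
  then have finc: "finite {card X | X. connected_safe_set ?G X}"
    by (rule rev_finite_subset) (use sub in blast)
  have low: "card S \<le> card X" if "safe_set ?G X" for X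
    using alpha_le_card_safe_set_rook[OF assms that] S(2) by simp
  have "safe_number ?G = card S" unfolding safe_number_def
    by (rule Min_eqI[OF fin]) (use low S sub in auto)
  moreover have "connected_safe_number ?G = card S" unfolding connected_safe_number_def
    by (rule Min_eqI[OF finc]) (use low S sub in auto)
  ultimately show ?thesis using S(2) by simp
qed

end
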